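(* Let $p$ be a positive integer and let $G$ be a $\{\text{butterfly},\text{hammer},C_4+K_p\}$-free graph such that no connected component of $G$ has clique number two. Then $\chi(G)\leq \omega(G)+\frac{p(p+1)}{2}$.
   Context: All graphs are simple, finite and undirected. $\omega(G)$ is the clique number and $\chi(G)$ the chromatic number of $G$. For a family $\mathcal{F}$ of graphs, $G$ is $\mathcal{F}$-free if it has no induced subgraph isomorphic to a member of $\mathcal{F}$. The butterfly is the graph on five vertices consisting of two triangles sharing exactly one vertex (with no other edges). The hammer is the graph on five vertices $a,b,c,d,e$ with edges $ab,bc,ac,cd,de$. $C_4$ is the cycle on four vertices and $K_p$ the complete graph on $p$ vertices. For vertex-disjoint graphs $G_1,G_2$, the join $G_1+G_2$ is obtained from their disjoint union by adding all edges between $V(G_1)$ and $V(G_2)$. *)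

theory Defs
  imports "Graph_Theory.Digraph_Isomorphism"
begin

text \<open>
  Finite simple undirected graphs are the \<open>pair_graph\<close>s of \<open>Graph_Theory\<close>: an edge \<open>uv\<close> is
  represented by the two arcs \<open>(u, v)\<close> and \<open>(v, u)\<close>, and the null graph is allowed.
  The notions below use only the adjacency relation \<open>u \<rightarrow>\<^bsub>G\<^esub> v\<close>.
\<close>

definition clique :: "('a, 'b) pre_digraph \<Rightarrow> 'a set \<Rightarrow> bool" where
  "clique G S \<longleftrightarrow> S \<subseteq> verts G \<and> (\<forall>u\<in>S. \<forall>v\<in>S. u \<noteq> v \<longrightarrow> u \<rightarrow>\<^bsub>G\<^esub> v)"

definition clique_number :: "('a, 'b) pre_digraph \<Rightarrow> nat" where
  "clique_number G = Max (card ` {S. clique G S})"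

definition colourable :: "('a, 'b) pre_digraph \<Rightarrow> nat \<Rightarrow> bool" where
  "colourable G k \<longleftrightarrow> (\<exists>c :: 'a \<Rightarrow> nat. (\<forall>v\<in>verts G. c v < k) \<and>
     (\<forall>u\<in>verts G. \<forall>v\<in>verts G. u \<rightarrow>\<^bsub>G\<^esub> v \<longrightarrow> c u \<noteq> c v))"

definition chromatic_number :: "('a, 'b) pre_digraph \<Rightarrow> nat" where
  "chromatic_number G = (LEAST k. colourable G k)"

definition connected_components :: "('a, 'b) pre_digraph \<Rightarrow> ('a, 'b) pre_digraph set" where
  "connected_components G = {H. pre_digraph.max_subgraph G connected H}"

definition induced_free :: "('a, 'b) pre_digraph \<Rightarrow> ('c, 'd) pre_digraph \<Rightarrow> bool" where
  "induced_free G F \<longleftrightarrow> \<not> (\<exists>H. induced_subgraph H G \<and> digraph_iso H F)"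

text \<open>In the concrete graphs each edge is listed once; \<open>mk_symmetric\<close> adds the reverse arcs.\<close>

definition butterfly :: "nat pair_pre_digraph" where
  "butterfly = mk_symmetric (with_proj
     \<lparr>pverts = {0, 1, 2, 3, 4}, parcs = {(0, 1), (1, 2), (0, 2), (2, 3), (3, 4), (2, 4)}\<rparr>)"

definition hammer :: "nat pair_pre_digraph" where
  "hammer = mk_symmetric (with_proj
     \<lparr>pverts = {0, 1, 2, 3, 4}, parcs = {(0, 1), (1, 2), (0, 2), (2, 3), (3, 4)}\<rparr>)"

definition four_cycle :: "nat pair_pre_digraph" where
  "four_cycle = mk_symmetric (with_proj
     \<lparr>pverts = {0, 1, 2, 3}, parcs = {(0, 1), (1, 2), (2, 3), (3, 0)}\<rparr>)"

definition complete_graph :: "nat \<Rightarrow> nat pair_pre_digraph" where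
  "complete_graph p = \<lparr>pverts = {..<p}, parcs = {(u, v). u < p \<and> v < p \<and> u \<noteq> v}\<rparr>"

definition graph_join :: "'a pair_pre_digraph \<Rightarrow> 'b pair_pre_digraph \<Rightarrow> ('a + 'b) pair_pre_digraph"
  where
  "graph_join G H = \<lparr>pverts = pverts G <+> pverts H,
     parcs = {(Inl u, Inl v) | u v. (u, v) \<in> parcs G} \<union> {(Inr u, Inr v) | u v. (u, v) \<in> parcs H} \<union>
       {(Inl u, Inr v) | u v. u \<in> pverts G \<and> v \<in> pverts H} \<union>
       {(Inr v, Inl u) | u v. u \<in> pverts G \<and> v \<in> pverts H}\<rparr>"

end

(* Colour each component separately; only a component with a maximum clique K of size w >= 3 matters.
   For a vertex u let M(u) be the set of its non-neighbours in K. If u, v are adjacent and both sets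
   have at least two elements, then M(u) and M(v) share at most one vertex (hammer, butterfly and
   connectedness), so neither contains the other, u and v lie on a C4 with two vertices of K, and
   fewer than p vertices of K lie outside both M(u) and M(v).
   Number K by 0, ..., w - 1. The colour of u is a singleton or pair inside M(u), where pairs are
   restricted to {0, ..., p}; a pair is never shared by such u, v. If w <= p + 1, this suffices at once.
   If w >= p + 2, the vertices outside K with just one non-neighbour in K are pairwise non-adjacent
   and share the colour {0, p}; the other vertices are then coloured without the pair {0, p}. *)

theory Submission
  imports Defs
begin

subsection \<open>Colouring sets of natural numbers\<close>

text \<open>With \<open>n\<close> the clique number, the size is exactly the bound to be proved: the
  \<open>p + 1\<close> numbers up to \<open>p\<close> form \<open>p * (p + 1) div 2\<close> pairs.
  Sets serve as colours so that a colour can be a part of what a vertex misses in the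
  clique.\<close>

definition palette :: "nat \<Rightarrow> nat \<Rightarrow> nat set set" where
  "palette p n = (\<lambda>x. {x}) ` {..<n} \<union> {T. T \<subseteq> {..p} \<and> card T = 2}"

lemma finite_palette: "finite (palette p n)"
  by (auto simp: palette_def intro: finite_subset[of _ "Pow {..p}"])

lemma card_palette: "card (palette p n) = n + p * (p + 1) div 2"
proof -
  have "card {T. T \<subseteq> {..p} \<and> card T = 2} = p * (p + 1) div 2"
    by (simp add: n_subsets choose_two mult.commute)
  moreover have "card ((\<lambda>x. {x}) ` {..<n}) = n"
    by (simp add: card_image)
  moreover have "(\<lambda>x. {x}) ` {..<n} \<inter> {T. T \<subseteq> {..p} \<and> card T = 2} = {}"
    by auto
  ultimately show ?thesis
    unfolding palette_def
    by (subst card_Un_disjoint) (auto intro: finite_subset[of _ "Pow {..p}"])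
qed

lemma palette_mono: "m \<le> n \<Longrightarrow> palette p m \<subseteq> palette p n"
  by (auto simp: palette_def)

lemma obtain_pair:
  assumes "card S \<ge> 2"
  obtains T where "T \<subseteq> S" "card T = 2"
  using obtain_subset_with_card_n[OF assms] by metis

section \<open>Choosing a colour inside a given set\<close>

text \<open>For \<open>p \<in> S\<close> this is the last element of the block of consecutive
  numbers in \<open>S\<close> that starts at \<open>p\<close>.\<close>

definition run_end :: "nat \<Rightarrow> nat set \<Rightarrow> nat" where
  "run_end p S = (LEAST y. p \<le> y \<and> Suc y \<notin> S)"

lemma
  assumes "finite S"
  shows run_end_ge: "p \<le> run_end p S"
    and Suc_run_end: "Suc (run_end p S) \<notin> S"
proof -
  have "finite (insert p S)" using assms by simp
  then obtain y where "y > Max (insert p S)" by blast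
  then have "p \<le> y \<and> Suc y \<notin> S"
    using Max_ge[OF \<open>finite (insert p S)\<close>, of p] Max_ge[OF \<open>finite (insert p S)\<close>, of "Suc y"] by auto
  from LeastI[of "\<lambda>y. p \<le> y \<and> Suc y \<notin> S", OF this]
  show "p \<le> run_end p S" "Suc (run_end p S) \<notin> S"
    by (auto simp: run_end_def)
qed

lemma atLeastAtMost_run_end_subset:
  assumes "p \<in> S"
  shows "{p..run_end p S} \<subseteq> S"
proof
  fix y assume y: "y \<in> {p..run_end p S}"
  show "y \<in> S"
  proof (cases "y = p")
    case False
    then obtain z where z: "y = Suc z" "p \<le> z" using y by (cases y) auto
    then have "z < run_end p S" using y by auto
    from not_less_Least[OF this[unfolded run_end_def]] z show ?thesis by simp
  qed (use assms in simp)
qed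

text \<open>The pair \<open>{0, p}\<close> is reserved for other vertices, so a set that meets
  \<open>{..p}\<close> in exactly \<open>{0, p}\<close> must take a singleton: \<open>{0}\<close> if
  it contains everything from \<open>p\<close> to \<open>n - 1\<close>, and otherwise the end of its
  run from \<open>p\<close>. A set that meets \<open>{..p}\<close> in \<open>{p}\<close> also takes
  its run end, so that if such a colour agrees with one of the former kind, the next number is
  outside both sets.\<close>

definition set_colour :: "nat \<Rightarrow> nat \<Rightarrow> nat set \<Rightarrow> nat set" where
  "set_colour p n S =
    (let J = S \<inter> {..p} in
     if J = {} then {Max S}
     else if J = {p} then {run_end p S}
     else if J = {0, p} then {if n \<le> Suc (run_end p S) then 0 else run_end p S}
     else if card J = 1 then J
     else (SOME T. T \<subseteq> J \<and> card T = 2 \<and> T \<noteq> {0, p}))"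

text \<open>Two or more elements up to \<open>p\<close> that are not exactly \<open>0\<close> and
  \<open>p\<close> contain a pair other than \<open>{0, p}\<close>, so the \<open>SOME\<close> in
  the definition has a witness.\<close>

lemma set_colour_pair:
  assumes "card (S \<inter> {..p}) \<noteq> 0" "card (S \<inter> {..p}) \<noteq> 1" "S \<inter> {..p} \<noteq> {0, p}"
  shows "set_colour p n S \<subseteq> S \<inter> {..p} \<and> card (set_colour p n S) = 2 \<and> set_colour p n S \<noteq> {0, p}"
proof -
  let ?J = "S \<inter> {..p}"
  have "card ?J \<ge> 2" using assms by linarith
  have "\<exists>T. T \<subseteq> ?J \<and> card T = 2 \<and> T \<noteq> {0, p}"
  proof (cases "?J \<subseteq> {0, p}")
    case True
    moreover have "card {0, p} \<le> 2" by (simp add: card_insert_if)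
    ultimately have "?J = {0, p}"
      using \<open>card ?J \<ge> 2\<close> card_seteq[of "{0, p}" ?J] by simp
    with assms show ?thesis by simp
  next
    case False
    then obtain x where x: "x \<in> ?J" "x \<notin> {0, p}" by blast
    have "card (?J - {x}) \<ge> 1" using \<open>card ?J \<ge> 2\<close> x by simp
    then obtain y where y: "y \<in> ?J - {x}"
      by (metis card.empty ex_in_conv not_one_le_zero)
    then have "{x, y} \<subseteq> ?J" "card {x, y} = 2" "{x, y} \<noteq> {0, p}" using x by auto
    then show ?thesis by (intro exI[of _ "{x, y}"] conjI)
  qed
  from someI_ex[OF this] have "(SOME T. T \<subseteq> ?J \<and> card T = 2 \<and> T \<noteq> {0, p}) \<subseteq> ?J \<and>
      card (SOME T. T \<subseteq> ?J \<and> card T = 2 \<and> T \<noteq> {0, p}) = 2 \<and>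
      (SOME T. T \<subseteq> ?J \<and> card T = 2 \<and> T \<noteq> {0, p}) \<noteq> {0, p}" .
  moreover have "?J \<noteq> {}" using assms(1) by (metis card.empty)
  moreover have "?J \<noteq> {p}" using assms(2) by (metis is_singletonI is_singleton_altdef)
  ultimately show ?thesis
    using assms(2,3) unfolding set_colour_def Let_def by (simp only: if_False simp_thms)
qed

text \<open>Elimination rule that replaces unfolding \<open>set_colour\<close>. If
  \<open>p = 0\<close>, then \<open>{0, p}\<close> is \<open>{p}\<close> and falls under
  \<open>last\<close>; hence \<open>full\<close> and \<open>both\<close> provide
  \<open>p \<noteq> 0\<close>.\<close>

lemma set_colour_cases:
  assumes "finite S" "card S \<ge> 2"
  obtains
    (empty) "S \<inter> {..p} = {}" "set_colour p n S = {Max S}"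
  | (last) "S \<inter> {..p} = {p}" "set_colour p n S = {run_end p S}"
  | (full) "S \<inter> {..p} = {0, p}" "p \<noteq> 0" "n \<le> Suc (run_end p S)" "set_colour p n S = {0}"
  | (both) "S \<inter> {..p} = {0, p}" "p \<noteq> 0" "Suc (run_end p S) < n" "set_colour p n S = {run_end p S}"
  | (single) x where "S \<inter> {..p} = {x}" "x < p" "set_colour p n S = {x}"
  | (pair) "set_colour p n S \<subseteq> S \<inter> {..p}" "card (set_colour p n S) = 2" "set_colour p n S \<noteq> {0, p}"
proof -
  let ?J = "S \<inter> {..p}"
  have c0: "card ?J = 0 \<Longrightarrow> ?J = {}" and cp: "?J = {0, p} \<Longrightarrow> p = 0 \<Longrightarrow> ?J = {p}"
    by auto
  consider "?J = {}" | "?J = {p}" | "?J = {0, p}" "p \<noteq> 0" | "card ?J = 1" "?J \<noteq> {p}"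
    | "card ?J \<noteq> 0" "card ?J \<noteq> 1" "?J \<noteq> {0, p}"
    using c0 cp by blast
  then show ?thesis
  proof cases
    case 1 then show ?thesis by (intro empty) (auto simp: set_colour_def)
  next
    case 2 then show ?thesis by (intro last) (auto simp: set_colour_def)
  next
    case 3
    then have "set_colour p n S = {if n \<le> Suc (run_end p S) then 0 else run_end p S}"
      by (auto simp: set_colour_def)
    then show ?thesis using 3 full both by (cases "n \<le> Suc (run_end p S)") auto
  next
    case 4
    from 4(1) obtain x where x: "?J = {x}" by (rule card_1_singletonE)
    moreover from x have "x \<in> ?J" by simp
    then have "x < p" using 4 x by (cases "x = p") auto
    moreover have "set_colour p n S = {x}" using x \<open>x < p\<close> by (auto simp: set_colour_def)
    ultimately show ?thesis using single by blast
  next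
    case 5
    from set_colour_pair[OF this] show ?thesis using pair by blast
  qed
qed

lemma set_colour_subset:
  assumes "finite S" "card S \<ge> 2"
  shows "set_colour p n S \<subseteq> S"
  using assms
proof (cases rule: set_colour_cases[of S p n])
  case empty
  have "S \<noteq> {}" using assms by auto
  then show ?thesis using empty assms by simp
next
  case last
  then have "p \<in> S" by blast
  from atLeastAtMost_run_end_subset[OF this] run_end_ge[OF assms(1), of p] last show ?thesis by auto
next
  case both
  then have "p \<in> S" by blast
  from atLeastAtMost_run_end_subset[OF this] run_end_ge[OF assms(1), of p] both show ?thesis by auto
next
  case full
  then have "0 \<in> S" by blast
  then show ?thesis using full(4) by simp
next
  case (single x)
  then have "x \<in> S" by blast
  then show ?thesis using single(3) by simp
next
  case pair
  then show ?thesis by simp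
qed

lemma set_colour_shape:
  assumes "finite S" "card S \<ge> 2"
  obtains x where "set_colour p n S = {x}"
  | "set_colour p n S \<subseteq> {..p}" "card (set_colour p n S) = 2" "set_colour p n S \<noteq> {0, p}"
  using assms
proof (cases rule: set_colour_cases[of S p n])
  case pair
  show ?thesis by (rule that(2)) (use pair in simp_all)
qed (erule that(1))+

lemma set_colour_nonempty:
  assumes "finite S" "card S \<ge> 2"
  shows "set_colour p n S \<noteq> {}"
  using assms by (cases rule: set_colour_shape[of S p n]) auto

lemma set_colour_in_palette:
  assumes "S \<subseteq> {..<n}" "card S \<ge> 2" "p \<ge> 1"
  shows "set_colour p n S \<in> palette p n - {{0, p}}"
proof -
  have fin: "finite S" using assms finite_subset by blast
  have sub: "set_colour p n S \<subseteq> {..<n}" using set_colour_subset[OF fin assms(2)] assms by blast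
  have neq: "{x} \<noteq> {0, p}" for x using assms by auto
  show ?thesis
    using fin assms(2)
    by (cases rule: set_colour_shape[of S p n]) (use sub neq in \<open>auto simp: palette_def\<close>)
qed

text \<open>A run of \<open>p, p + 1, \<dots>\<close> in one set ends just before an element that is missed by both sets,
  but the condition on the union leaves no room for such an element.\<close>

lemma set_colour_proper:
  assumes p: "p \<ge> 1" "p + 2 \<le> n"
    and S: "S \<subseteq> {..<n}" "card S \<ge> 2" and S': "S' \<subseteq> {..<n}" "card S' \<ge> 2"
    and inter: "card (S \<inter> S') \<le> 1" and union: "card ({..<n} - (S \<union> S')) < p"
  shows "set_colour p n S \<noteq> set_colour p n S'"
proof
  assume eq: "set_colour p n S = set_colour p n S'"
  have fin: "finite S" "finite S'" using S S' finite_subset by blast+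
  have no2: False if "T \<subseteq> S" "T \<subseteq> S'" "card T = 2" for T
  proof -
    have "card T \<le> card (S \<inter> S')" using that fin by (intro card_mono) auto
    then show False using that inter by simp
  qed
  have no_two: False if "x \<in> S" "x \<in> S'" "y \<in> S" "y \<in> S'" "x \<noteq> y" for x y
    using no2[of "{x, y}"] that by simp
  have no_both: False if "S \<inter> {..p} = {0, p}" "S' \<inter> {..p} = {0, p}" "p \<noteq> 0"
    using no_two[of 0 p] that by blast
  have missed: "card ({..p} - (S \<union> S')) + card ((S \<union> S') \<inter> {..p}) = Suc p"
    using card_Int_Diff[of "{..p}" "S \<union> S'"] by (simp add: Int_commute)
  \<comment> \<open>Otherwise at least \<open>p\<close> of the \<open>p + 1\<close> numbers up to
    \<open>p\<close> are missed by both sets.\<close>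
  have F1: "card ((S \<union> S') \<inter> {..p}) \<ge> 2"
  proof (rule ccontr)
    assume "\<not> ?thesis"
    then have "card ({..p} - (S \<union> S')) \<ge> p" using missed by linarith
    moreover have "card ({..p} - (S \<union> S')) \<le> card ({..<n} - (S \<union> S'))"
      using p by (intro card_mono) auto
    ultimately show False using union by simp
  qed
  \<comment> \<open>At least \<open>p - 1\<close> numbers up to \<open>p\<close> are already missed
    by both sets, so a missed \<open>y\<close> above \<open>p\<close> would be one too many.\<close>
  have F2: "y \<in> S \<union> S'" if "card ((S \<union> S') \<inter> {..p}) \<le> 2" "p < y" "y < n" for y
  proof (rule ccontr)
    assume "y \<notin> S \<union> S'"
    then have "insert y ({..p} - (S \<union> S')) \<subseteq> {..<n} - (S \<union> S')" using that by auto
    then have "card (insert y ({..p} - (S \<union> S'))) \<le> card ({..<n} - (S \<union> S'))"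
      by (intro card_mono) auto
    moreover have "card (insert y ({..p} - (S \<union> S'))) = Suc (card ({..p} - (S \<union> S')))"
      using that by simp
    ultimately show False using union missed that(1) by linarith
  qed
  \<comment> \<open>The colour of \<open>T\<close> is its run end, which in the applications is also
    the maximum or the run end of \<open>T'\<close>. So the next number lies in neither set, against
    \<open>F2\<close>.\<close>
  have case_both: False
    if "finite T" "finite T'" "T \<inter> {..p} = {0, p}" "Suc (run_end p T) < n" "Suc (run_end p T) \<notin> T'"
      "T' \<inter> {..p} \<subseteq> {p}" "S \<union> S' = T \<union> T'" for T T'
  proof -
    have "(S \<union> S') \<inter> {..p} = T \<inter> {..p} \<union> T' \<inter> {..p}" using that(7) by blast
    then have "(S \<union> S') \<inter> {..p} = {0, p}" using that(3,6) by blast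
    then have "card ((S \<union> S') \<inter> {..p}) \<le> 2" by (simp add: card_insert_if)
    from F2[OF this, of "Suc (run_end p T)"] have "Suc (run_end p T) \<in> T \<union> T'"
      using run_end_ge[OF that(1), of p] that by simp
    then show False using Suc_run_end[OF that(1)] that by auto
  qed
  have Suc_Max: "Suc (Max T) \<notin> T" if "finite T" for T :: "nat set"
    using Max_ge[OF that, of "Suc (Max T)"] by auto
  \<comment> \<open>Here both colours are \<open>{0}\<close>. As \<open>T\<close> contains all
    numbers from \<open>p\<close> to \<open>n - 1\<close>, a second element of \<open>T'\<close> is
    also in \<open>T\<close> and, with \<open>0\<close>, gives two common elements.\<close>
  have case_full: False
    if "finite T" "finite T'" "T \<inter> {..p} = {0, p}" "n \<le> Suc (run_end p T)" "T' \<inter> {..p} = {0}"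
      "T' \<subseteq> {..<n}" "card T' \<ge> 2"
      "T \<inter> T' = S \<inter> S'" for T T'
  proof -
    have "\<not> T' \<subseteq> {0}" using card_mono[of "{0}" T'] that by auto
    then obtain y where y: "y \<in> T'" "y \<noteq> 0" by blast
    have "p < y" using y that(5) by (metis IntI atMost_iff not_le_imp_less singletonD)
    moreover have "p \<in> T" using that by auto
    ultimately have "y \<in> T"
      using atLeastAtMost_run_end_subset[of p T] y(1) that(4,6) by force
    moreover have "0 \<in> T" "0 \<in> T'" using that(3,5) by auto
    ultimately have "0 \<in> S \<inter> S'" "y \<in> S \<inter> S'" using y(1) that(8) by blast+
    then show False using no_two[of 0 y] y(2) by blast
  qed
  have J: "(S \<union> S') \<inter> {..p} = S \<inter> {..p} \<union> S' \<inter> {..p}" by blast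
  \<comment> \<open>Apart from these two situations, the colours differ in size or in position
    relative to \<open>p\<close>, or the combination is excluded by \<open>F1\<close> or by the
    bound on the intersection.\<close>
  show False
    using fin(1) S(2)
  proof (cases rule: set_colour_cases[of S p n])
    case pair
    then show False using no2[of "set_colour p n S"] eq
      set_colour_subset[OF fin(1) S(2)] set_colour_subset[OF fin(2) S'(2)] by simp
  next
    case a: empty
    have "p < Max S" using a(1) Max_in[OF fin(1)] S(2)
      by (metis IntI atMost_iff card.empty empty_iff not_le_imp_less not_numeral_le_zero)
    show False using fin(2) S'(2)
    proof (cases rule: set_colour_cases[of S' p n])
      case both
      show False
        by (rule case_both[of S' S]) (use both a fin eq Suc_Max[OF fin(1)] in auto)
    qed (use a eq F1 J \<open>p < Max S\<close> in auto)
  next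
    case a: last
    show False using fin(2) S'(2)
    proof (cases rule: set_colour_cases[of S' p n])
      case both
      show False
        by (rule case_both[of S' S]) (use both a fin eq Suc_run_end[OF fin(1), of p] in auto)
    qed (use a eq F1 J run_end_ge[OF fin(1), of p] in auto)
  next
    case a: full
    have "0 \<in> S" "p \<in> S" using a by blast+
    show False using fin(2) S'(2)
    proof (cases rule: set_colour_cases[of S' p n])
      case (single x)
      show False
        by (rule case_full[of S S']) (use single a eq fin S' in auto)
    next
      case empty
      then have "0 \<in> S'" using a eq set_colour_subset[OF fin(2) S'(2), of p n] by auto
      then show False using empty by auto
    next
      case last
      then show False using a eq run_end_ge[OF fin(2), of p] by auto
    next
      case full
      then show False using a no_both by blast
    next
      case both
      then show False using a no_both by blast
    next
      case pair
      then show False using a eq by simp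
    qed
  next
    case a: both
    show False using fin(2) S'(2)
    proof (cases rule: set_colour_cases[of S' p n])
      case empty
      show False
        by (rule case_both[of S S']) (use empty a fin eq Suc_Max[OF fin(2)] in auto)
    next
      case last
      show False
        by (rule case_both[of S S']) (use last a fin eq Suc_run_end[OF fin(2), of p] in auto)
    next
      case (single x)
      then show False using a eq run_end_ge[OF fin(1), of p] by auto
    next
      case full
      then show False using a no_both by blast
    next
      case both
      then show False using a no_both by blast
    next
      case pair
      then show False using a eq by simp
    qed
  next
    case a: (single x)
    show False using fin(2) S'(2)
    proof (cases rule: set_colour_cases[of S' p n])
      case full
      show False
        by (rule case_full[of S' S]) (use full a eq fin S in auto)
    next
      case both
      then show False using a eq run_end_ge[OF fin(2), of p] by auto
    next
      case last
      then show False using a eq run_end_ge[OF fin(2), of p] by auto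
    next
      case empty
      then show False using a F1 J by simp
    next
      case (single y)
      then show False using a eq F1 J by simp
    next
      case pair
      then show False using a eq by simp
    qed
  qed
qed

subsection \<open>A component with a maximum clique of size at least three\<close>

text \<open>Freeness in terms of adjacency alone. For butterfly and hammer, distinctness of the five
  vertices follows from the edges and non-edges; opposite vertices of the four-cycle are separated
  explicitly.\<close>

locale forbidden_free =
  fixes E :: "'a \<Rightarrow> 'a \<Rightarrow> bool" and p :: nat
  assumes sym: "E x y \<Longrightarrow> E y x"
    and irrefl: "\<not> E x x"
    and no_butterfly: "E a b \<Longrightarrow> E a c \<Longrightarrow> E b c \<Longrightarrow> E c d \<Longrightarrow> E c e \<Longrightarrow> E d e \<Longrightarrow>
      E a d \<or> E a e \<or> E b d \<or> E b e"
    and no_hammer: "E a b \<Longrightarrow> E a c \<Longrightarrow> E b c \<Longrightarrow> E c d \<Longrightarrow> E d e \<Longrightarrow>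
      E a d \<or> E a e \<or> E b d \<or> E b e \<or> E c e"
    and no_C4_join: "E w x \<Longrightarrow> E x y \<Longrightarrow> E y z \<Longrightarrow> E z w \<Longrightarrow> w \<noteq> y \<Longrightarrow> x \<noteq> z \<Longrightarrow> \<not> E w y \<Longrightarrow> \<not> E x z \<Longrightarrow>
      finite Q \<Longrightarrow> (\<And>u v. u \<in> Q \<Longrightarrow> v \<in> Q \<Longrightarrow> u \<noteq> v \<Longrightarrow> E u v) \<Longrightarrow>
      (\<And>u. u \<in> Q \<Longrightarrow> E w u \<and> E x u \<and> E y u \<and> E z u) \<Longrightarrow> card Q \<noteq> p"

text \<open>Connectedness is expressed through closed sets instead of paths, the form that yields an
  edge leaving a given set.\<close>

locale component_max_clique = forbidden_free E p
  for E :: "'a \<Rightarrow> 'a \<Rightarrow> bool" and p :: nat +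
  fixes V K :: "'a set"
  assumes finite_V: "finite V"
    and connected_V: "S \<subseteq> V \<Longrightarrow> S \<noteq> {} \<Longrightarrow> (\<And>x y. x \<in> S \<Longrightarrow> E x y \<Longrightarrow> y \<in> S) \<Longrightarrow> S = V"
    and closed_V: "x \<in> V \<Longrightarrow> E x y \<Longrightarrow> y \<in> V"
    and K_V: "K \<subseteq> V"
    and K_clique: "u \<in> K \<Longrightarrow> v \<in> K \<Longrightarrow> u \<noteq> v \<Longrightarrow> E u v"
    and K_max: "S \<subseteq> V \<Longrightarrow> (\<And>u v. u \<in> S \<Longrightarrow> v \<in> S \<Longrightarrow> u \<noteq> v \<Longrightarrow> E u v) \<Longrightarrow> card S \<le> card K"
    and card_K: "card K \<ge> 3"
    and p_pos: "p \<ge> 1"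
begin

section \<open>Vertices of the maximum clique missed by the ends of an edge\<close>

text \<open>A vertex of \<open>K\<close> misses itself, so vertices inside and outside
  \<open>K\<close> are treated alike.\<close>

definition missed :: "'a \<Rightarrow> 'a set" where
  "missed u = {k \<in> K. \<not> E u k}"

lemma finite_K: "finite K"
  using finite_V K_V finite_subset by blast

lemma missed_subset: "missed u \<subseteq> K"
  by (auto simp: missed_def)

lemma missed_K: "u \<in> K \<Longrightarrow> missed u = {u}"
  using K_clique irrefl by (auto simp: missed_def)

text \<open>A vertex adjacent to all of \<open>K\<close> would extend it to a larger clique.\<close>

lemma missed_nonempty:
  assumes "u \<in> V"
  shows "missed u \<noteq> {}"
proof
  assume "missed u = {}"
  then have adj: "E u k" if "k \<in> K" for k using that by (auto simp: missed_def)
  then have "u \<notin> K" using irrefl by blast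
  have "card (insert u K) \<le> card K"
    using assms K_V adj sym K_clique by (intro K_max) auto
  then show False using \<open>u \<notin> K\<close> finite_K by simp
qed

text \<open>The common neighbours in \<open>K\<close> form a clique, so \<open>p\<close> of them
  would complete the forbidden join with the induced four-cycle.\<close>

lemma few_common_neighbours:
  assumes "E w x" "E x y" "E y z" "E z w" "w \<noteq> y" "x \<noteq> z" "\<not> E w y" "\<not> E x z"
  shows "card {k \<in> K. E w k \<and> E x k \<and> E y k \<and> E z k} < p"
proof (rule ccontr)
  assume "\<not> ?thesis"
  then obtain Q where Q: "Q \<subseteq> {k \<in> K. E w k \<and> E x k \<and> E y k \<and> E z k}" "card Q = p"
    by (meson not_less obtain_subset_with_card_n)
  have "card Q \<noteq> p"
    using Q finite_K K_clique finite_subset[of Q K]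
    by (intro no_C4_join[OF assms]) auto
  then show False using Q by simp
qed

text \<open>Replacing \<open>i\<close> in \<open>K\<close> by both \<open>u\<close> and
  \<open>w\<close> would give a larger clique.\<close>

lemma same_missed_not_adj:
  assumes "u \<in> V" "w \<in> V" "missed u = {i}" "missed w = {i}"
  shows "\<not> E u w"
proof
  assume "E u w"
  have i: "i \<in> K" "\<not> E u i" "\<not> E w i" using assms by (auto simp: missed_def)
  then have "u \<noteq> i" "w \<noteq> i" using \<open>E u w\<close> sym by blast+
  then have "u \<notin> K" "w \<notin> K" using assms missed_K by auto
  have adj: "E u k" "E w k" if "k \<in> K" "k \<noteq> i" for k
    using that assms by (auto simp: missed_def)
  have "card (insert u (insert w (K - {i}))) \<le> card K"
    using assms(1,2) K_V adj sym K_clique \<open>E u w\<close> by (intro K_max) auto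
  moreover have "u \<noteq> w" using \<open>E u w\<close> irrefl by blast
  then have "card (insert u (insert w (K - {i}))) = card (K - {i}) + 2"
    using \<open>u \<notin> K\<close> \<open>w \<notin> K\<close> finite_K by simp
  moreover have "card (K - {i}) = card K - 1" using i(1) by simp
  ultimately show False using card_K by linarith
qed

text \<open>If \<open>u\<close> and \<open>w\<close> are adjacent, their missed vertices
  \<open>i\<close> and \<open>j\<close> differ by \<open>same_missed_not_adj\<close>. Then
  \<open>u\<close>, \<open>j\<close>, \<open>i\<close>, \<open>w\<close> is an induced four-cycle
  joined to the rest of \<open>K\<close>, which has at least \<open>p\<close> vertices.\<close>

lemma missed_one_not_adj:
  assumes "u \<in> V - K" "w \<in> V - K" "card (missed u) = 1" "card (missed w) = 1" "p + 2 \<le> card K"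
  shows "\<not> E u w"
proof
  assume "E u w"
  obtain i j where i: "missed u = {i}" and j: "missed w = {j}"
    using assms(3,4) by (meson card_1_singletonE)
  have ij: "i \<in> K" "\<not> E u i" "j \<in> K" "\<not> E w j" using i j by (auto simp: missed_def)
  have "i \<noteq> j" using same_missed_not_adj[of u w i] i j \<open>E u w\<close> assms(1,2) by auto
  have u: "E u k" if "k \<in> K" "k \<noteq> i" for k using that i by (auto simp: missed_def)
  have w: "E w k" if "k \<in> K" "k \<noteq> j" for k using that j by (auto simp: missed_def)
  have "card {k \<in> K. E u k \<and> E j k \<and> E i k \<and> E w k} < p"
    using ij \<open>i \<noteq> j\<close> u w sym K_clique \<open>E u w\<close> assms(1,2)
    by (intro few_common_neighbours) auto
  moreover have "card (K - {i, j}) \<le> card {k \<in> K. E u k \<and> E j k \<and> E i k \<and> E w k}"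
    using u w K_clique ij finite_K by (intro card_mono) auto
  moreover have "card (K - {i, j}) = card K - 2"
    using ij \<open>i \<noteq> j\<close> by (simp add: card_Diff_subset)
  ultimately show False using assms(5) by linarith
qed

text \<open>By connectedness some edge of this kind has an end \<open>x\<close> adjacent to a vertex \<open>y\<close> that has a
  neighbour in \<open>K\<close>. Then \<open>y\<close> misses at most one vertex of \<open>K\<close>, and two of its neighbours in \<open>K\<close> span
  a butterfly or hammer with \<open>y\<close> and the edge.\<close>

lemma no_edge_far_from_K:
  assumes "u \<in> V" "E u w" "missed u = K" "missed w = K"
  shows False
proof -
  define S where "S = {z \<in> V. missed z = K \<and> (\<exists>z'. E z z' \<and> missed z' = K)}"
  have "K \<noteq> {}" using card_K by auto
  \<comment> \<open>A vertex of \<open>K\<close> misses only itself, whereas \<open>K\<close> has at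
    least three vertices.\<close>
  have "S \<noteq> V"
  proof
    assume "S = V"
    obtain k where "k \<in> K" using \<open>K \<noteq> {}\<close> by blast
    then have "missed k = K" using \<open>S = V\<close> K_V by (auto simp: S_def)
    then have "K = {k}" using missed_K[OF \<open>k \<in> K\<close>] by simp
    then have "card K = 1" by simp
    then show False using card_K by simp
  qed
  moreover have "S \<subseteq> V" "S \<noteq> {}" using assms by (auto simp: S_def)
  ultimately obtain x y where xy: "x \<in> S" "E x y" "y \<notin> S"
    using connected_V[of S] by blast
  then have "y \<in> V" and x: "missed x = K" using closed_V[of x y] by (auto simp: S_def)
  then have "missed y \<noteq> K" using xy sym by (auto simp: S_def)
  obtain x' where x': "E x x'" "missed x' = K" using xy by (auto simp: S_def)
  have far: "\<not> E x k" "\<not> E k x" "\<not> E x' k" "\<not> E k x'" if "k \<in> K" for k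
    using that x x' sym by (auto simp: missed_def)
  obtain c where c: "c \<in> K" "E y c" using \<open>missed y \<noteq> K\<close> by (auto simp: missed_def)
  have "y \<notin> K" using xy far by blast
  \<comment> \<open>Otherwise the triangle \<open>a\<close>, \<open>b\<close>, \<open>c\<close> with
    the path \<open>c\<close>, \<open>y\<close>, \<open>x\<close> is a hammer.\<close>
  have "a = b" if "a \<in> missed y" "b \<in> missed y" for a b
  proof (rule ccontr)
    assume "a \<noteq> b"
    have ab: "a \<in> K" "b \<in> K" "\<not> E y a" "\<not> E y b" using that by (auto simp: missed_def)
    moreover from this have "a \<noteq> c" "b \<noteq> c" using c by auto
    ultimately have "E a b" "E a c" "E b c" "\<not> E a y" "\<not> E b y"
      using K_clique \<open>a \<noteq> b\<close> c(1) sym[of a y] sym[of b y] by auto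
    then show False
      using no_hammer[of a b c y x] sym[OF c(2)] sym[OF xy(2)] far ab c(1) by simp
  qed
  then have "card (missed y) \<le> 1"
    using finite_subset[OF missed_subset finite_K]
    by (metis One_nat_def card_le_Suc0_iff_eq)
  moreover have "card (K - missed y) = card K - card (missed y)"
    using missed_subset finite_subset[OF missed_subset finite_K] by (intro card_Diff_subset)
  ultimately have "2 \<le> card (K - missed y)" using card_K by linarith
  then obtain T where "T \<subseteq> K - missed y" "card T = 2" by (rule obtain_pair)
  then obtain a b where "a \<in> K" "b \<in> K" "a \<noteq> b" "E y a" "E y b"
    by (auto simp: card_2_iff missed_def)
  \<comment> \<open>The triangle \<open>a\<close>, \<open>b\<close>, \<open>y\<close> and the edge
    from \<open>x\<close> to \<open>x'\<close> form a butterfly if \<open>y\<close> is adjacent to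
    \<open>x'\<close>, and a hammer otherwise.\<close>
  then show False
    using no_hammer[of a b y x x'] no_butterfly[of a b y x x'] K_clique[of a b]
      sym[of y a] sym[of y b] sym[OF xy(2)] x'(1) far by simp
qed

text \<open>Suppose both ends miss \<open>i\<close> and \<open>j\<close>. A vertex \<open>k\<close>
  of \<open>K\<close> adjacent to an end would form a triangle with \<open>i\<close> and
  \<open>j\<close>; together with the edge this is a butterfly if \<open>k\<close> sees both ends
  and a hammer if it sees one. So both ends miss all of \<open>K\<close>, against
  \<open>no_edge_far_from_K\<close>.\<close>

lemma adj_missed_inter:
  assumes "u \<in> V" "E u w"
  shows "card (missed u \<inter> missed w) \<le> 1"
proof (rule ccontr)
  assume "\<not> ?thesis"
  then have "card (missed u \<inter> missed w) \<ge> 2" by simp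
  then obtain T where "T \<subseteq> missed u \<inter> missed w" "card T = 2" by (rule obtain_pair)
  then obtain i j where ij: "i \<in> K" "j \<in> K" "i \<noteq> j"
    "\<not> E u i" "\<not> E u j" "\<not> E w i" "\<not> E w j"
    by (auto simp: card_2_iff missed_def)
  have "\<not> E u k \<and> \<not> E w k" if "k \<in> K" for k
  proof (rule ccontr)
    assume *: "\<not> ?thesis"
    have "E i j" "k \<noteq> i" "k \<noteq> j" using * ij K_clique by auto
    then have "E i k" "E j k" using ij that K_clique by auto
    then show False
      using no_butterfly[of i j k u w] no_hammer[of i j k u w] no_hammer[of i j k w u]
        * ij \<open>E i j\<close> assms(2) sym by blast
  qed
  then have "missed u = K" "missed w = K" by (auto simp: missed_def)
  then show False using no_edge_far_from_K assms by blast
qed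

text \<open>By \<open>adj_missed_inter\<close> neither missed set contains the other. Vertices
  \<open>i\<close> and \<open>j\<close> from the two differences give the induced four-cycle
  \<open>u\<close>, \<open>j\<close>, \<open>i\<close>, \<open>w\<close>, and each vertex of
  \<open>K\<close> missed by neither end is a common neighbour of it.\<close>

lemma adj_missed_union:
  assumes "u \<in> V" "E u w" "card (missed u) \<ge> 2" "card (missed w) \<ge> 2"
  shows "card (K - (missed u \<union> missed w)) < p"
proof -
  have inter: "card (missed u \<inter> missed w) \<le> 1" using adj_missed_inter assms by blast
  then have "\<not> missed u \<subseteq> missed w" using assms(3) by (auto simp: Int_absorb2)
  then obtain i where i: "i \<in> K" "\<not> E u i" "E w i" by (auto simp: missed_def)
  have "\<not> missed w \<subseteq> missed u" using assms(4) inter by (auto simp: Int_absorb1)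
  then obtain j where j: "j \<in> K" "\<not> E w j" "E u j" by (auto simp: missed_def)
  have "i \<noteq> j" using i j by auto
  have "u \<notin> K" "w \<notin> K" using assms(3,4) missed_K by force+
  then have "card {k \<in> K. E u k \<and> E j k \<and> E i k \<and> E w k} < p"
    using i j \<open>i \<noteq> j\<close> sym K_clique assms(2) by (intro few_common_neighbours) auto
  moreover have "card (K - (missed u \<union> missed w)) \<le> card {k \<in> K. E u k \<and> E j k \<and> E i k \<and> E w k}"
    using i j K_clique finite_K by (intro card_mono) (auto simp: missed_def)
  ultimately show ?thesis by linarith
qed

section \<open>Colouring the component\<close>

lemma colouring_exists:
  "\<exists>c. (\<forall>v\<in>V. c v \<in> palette p (card K)) \<and> (\<forall>u\<in>V. \<forall>v\<in>V. E u v \<longrightarrow> c u \<noteq> c v)"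
proof -
  define n where "n = card K"
  obtain h where h: "bij_betw h K {..<n}"
    using ex_bij_betw_finite_nat[OF finite_K] by (auto simp: n_def atLeast0LessThan)
  have inj: "inj_on h K" and img: "h ` K = {..<n}" using h by (auto simp: bij_betw_def)
  \<comment> \<open>Numbering \<open>K\<close> by \<open>h\<close> turns missed sets into sets of
    numbers, where \<open>set_colour\<close> applies.\<close>
  define M where "M u = h ` missed u" for u
  have M_sub: "M u \<subseteq> {..<n}" for u using img missed_subset by (auto simp: M_def)
  have fin_M: "finite (M u)" for u using M_sub finite_subset by blast
  have inj': "inj_on h (missed u)" for u using inj missed_subset by (rule inj_on_subset)
  have card_M: "card (M u) = card (missed u)" for u
    unfolding M_def by (rule card_image[OF inj'])
  have M_pos: "card (M u) \<noteq> 0" if "u \<in> V" for u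
    using missed_nonempty[OF that] fin_M by (auto simp: M_def)
  have M_K: "M k = {h k}" if "k \<in> K" for k using missed_K[OF that] by (simp add: M_def)
  have M_one: "\<exists>i\<in>K. M u = {h i} \<and> missed u = {i}" if "card (M u) = 1" for u
    using that missed_subset[of u] unfolding card_M by (auto simp: card_1_singleton_iff M_def)
  have inter: "card (M u \<inter> M w) \<le> 1" if "u \<in> V" "E u w" for u w
  proof -
    have "M u \<inter> M w = h ` (missed u \<inter> missed w)"
      unfolding M_def using inj_on_image_Int[OF inj missed_subset missed_subset] by simp
    then show ?thesis using adj_missed_inter[OF that] card_image_le
      finite_subset[OF missed_subset finite_K] by (metis finite_Int order_trans)
  qed
  have K_not: "\<not> E k u" if kM: "k \<in> K" "h k \<in> M u" for k u
  proof -
    obtain k' where "k' \<in> K" "\<not> E u k'" "h k = h k'"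
      using kM(2) unfolding M_def missed_def by blast
    then show ?thesis using inj_onD[OF inj, of k k'] kM(1) sym by auto
  qed
  have same: "\<not> E u w" if uw: "u \<in> V" "w \<in> V" "card (M u) = 1" "M u = M w" for u w
  proof -
    obtain i j where "missed u = {i}" "missed w = {j}" "M u = {h i}" "M w = {h j}" "i \<in> K" "j \<in> K"
      using M_one[of u] M_one[of w] uw by auto
    then show ?thesis using uw same_missed_not_adj[of u w i] inj_onD[OF inj, of i j] by auto
  qed
  show ?thesis
  proof (cases "n \<ge> p + 2")
    case True
    define c where "c v = (if card (M v) \<ge> 2 then set_colour p n (M v)
      else if v \<in> K then M v else {0, p})" for v
    have pair: "{0, p} \<in> palette p n" using p_pos by (auto simp: palette_def)
    have long: "c v \<in> palette p n - {{0, p}} \<and> c v \<subseteq> M v \<and> c v \<noteq> {}" if "card (M v) \<ge> 2" for v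
      using that set_colour_in_palette[OF M_sub that p_pos] set_colour_subset[OF fin_M that]
        set_colour_nonempty[OF fin_M that] by (simp add: c_def)
    have cK: "c k = {h k}" if "k \<in> K" for k using that M_K by (simp add: c_def)
    have cA: "c v = {0, p} \<and> card (M v) = 1" if "v \<in> V - K" "\<not> card (M v) \<ge> 2" for v
    proof -
      have "card (M v) \<noteq> 0" using that M_pos by blast
      then show ?thesis using that by (auto simp: c_def)
    qed
    have neq: "{x} \<noteq> {0, p}" for x using p_pos by auto
    \<comment> \<open>A colour inside \<open>M u\<close> cannot be \<open>{h k}\<close>, because
      adjacency keeps \<open>h k\<close> out of \<open>M u\<close>.\<close>
    have KM: "c k \<noteq> c u" if "k \<in> K" "u \<in> V" "E k u" for k u
    proof (cases "u \<in> K")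
      case True
      then have "h k \<noteq> h u" using that irrefl inj_onD[OF inj] by metis
      then show ?thesis using cK that True by simp
    next
      case False
      show ?thesis
      proof (cases "card (M u) \<ge> 2")
        case True
        then show ?thesis using long[OF True] cK[OF that(1)] K_not[OF that(1), of u] that(3) by auto
      next
        case False
        then show ?thesis using cA[of u] cK[OF that(1)] neq \<open>u \<notin> K\<close> that(2) by simp
      qed
    qed
    have "c v \<in> palette p n" if "v \<in> V" for v
    proof (cases "v \<in> K")
      case True
      then show ?thesis using cK img by (auto simp: palette_def)
    next
      case False
      then show ?thesis using that long cA pair by (metis Diff_iff)
    qed
    moreover have "c u \<noteq> c v" if uv: "u \<in> V" "v \<in> V" "E u v" for u v
    proof (cases "u \<in> K \<or> v \<in> K")
      case True
      then show ?thesis using KM uv sym by metis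
    next
      case False
      then have out: "u \<in> V - K" "v \<in> V - K" using uv by auto
      consider "card (M u) \<ge> 2" "card (M v) \<ge> 2" | "card (M u) \<ge> 2" "\<not> card (M v) \<ge> 2"
        | "\<not> card (M u) \<ge> 2" "card (M v) \<ge> 2" | "\<not> card (M u) \<ge> 2" "\<not> card (M v) \<ge> 2"
        by blast
      then show ?thesis
      proof cases
        case 1
        have "{..<n} - (M u \<union> M v) = h ` (K - (missed u \<union> missed v))"
          unfolding M_def img[symmetric] image_Un[symmetric]
          by (rule inj_on_image_set_diff[OF inj, symmetric]) (use missed_subset in auto)
        then have "card ({..<n} - (M u \<union> M v)) < p"
          using adj_missed_union[OF uv(1,3)] 1 finite_K card_image_le[of "K - (missed u \<union> missed v)" h]
          by (simp add: card_M)
        then show ?thesis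
          using set_colour_proper[OF p_pos True M_sub 1(1) M_sub 1(2) inter[OF uv(1,3)]] 1
          by (simp add: c_def)
      next
        \<comment> \<open>\<open>set_colour\<close> never returns the reserved pair carried by the
          other end.\<close>
        case 2
        then show ?thesis using long[of u] cA[OF out(2)] by (metis DiffD2 insertI1)
      next
        case 3
        then show ?thesis using long[of v] cA[OF out(1)] by (metis DiffD2 insertI1)
      next
        case 4
        \<comment> \<open>These two vertices share the colour \<open>{0, p}\<close>, so they have to
          be non-adjacent.\<close>
        then show ?thesis
          using missed_one_not_adj[OF out] cA[OF out(1)] cA[OF out(2)] uv(3) True
          by (simp add: card_M n_def)
      qed
    qed
    ultimately show ?thesis unfolding n_def by blast
  next
    case False
    \<comment> \<open>Here \<open>n \<le> p + 1\<close>, so every pair of numbers below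
      \<open>n\<close> is in the palette and any pair inside \<open>M v\<close> will do.\<close>
    define c where "c v = (if card (M v) \<ge> 2 then (SOME T. T \<subseteq> M v \<and> card T = 2) else M v)" for v
    have long: "c v \<subseteq> M v \<and> card (c v) = 2" if "card (M v) \<ge> 2" for v
    proof -
      have "\<exists>T. T \<subseteq> M v \<and> card T = 2" using obtain_pair[OF that] by metis
      from someI_ex[OF this] show ?thesis using that by (simp add: c_def)
    qed
    have short: "c v = M v \<and> card (M v) = 1" if "v \<in> V" "\<not> card (M v) \<ge> 2" for v
      using that M_pos[OF that(1)] by (auto simp: c_def)
    have "c v \<in> palette p n" if "v \<in> V" for v
    proof (cases "card (M v) \<ge> 2")
      case True
      moreover have "{..<n} \<subseteq> {..p}" using False by auto
      ultimately show ?thesis using long[OF True] M_sub[of v] by (auto simp: palette_def)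
    next
      case False
      then show ?thesis using short[OF that False] M_one[of v] img by (auto simp: palette_def)
    qed
    moreover have "c u \<noteq> c v" if uv: "u \<in> V" "v \<in> V" "E u v" for u v
    proof
      assume eq: "c u = c v"
      show False
      proof (cases "card (M u) \<ge> 2")
        case True
        then have "card (M v) \<ge> 2" using eq long[of u] short[of v] uv by fastforce
        then have "c u \<subseteq> M u \<inter> M v" "card (c u) = 2" using True long eq by auto
        then have "2 \<le> card (M u \<inter> M v)" using fin_M by (metis card_mono finite_Int)
        then show False using inter[OF uv(1,3)] by simp
      next
        case F: False
        then have "\<not> card (M v) \<ge> 2" using eq long[of v] short[of u] uv by fastforce
        then have "M u = M v" "card (M u) = 1" using F short[of u] short[of v] eq uv by simp_all
        then show False using same[of u v] uv by blast
      qed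
    qed
    ultimately show ?thesis unfolding n_def by blast
  qed
qed

end

subsection \<open>Induced subgraphs and components\<close>

text \<open>The copy is the subgraph induced on the image of \<open>g\<close>, and its isomorphism
  onto \<open>F\<close> is the inverse of \<open>g\<close>.\<close>

lemma induced_copy_not_free:
  assumes "pair_wf_digraph G" and F: "parcs F \<subseteq> pverts F \<times> pverts F"
    and inj: "inj_on g (pverts F)" and sub: "g ` pverts F \<subseteq> pverts G"
    and adj: "\<And>u v. u \<in> pverts F \<Longrightarrow> v \<in> pverts F \<Longrightarrow> (g u, g v) \<in> parcs G \<longleftrightarrow> (u, v) \<in> parcs F"
  shows "\<not> induced_free (with_proj G) (with_proj F)"
proof -
  interpret pair_wf_digraph G by fact
  define W where "W = g ` pverts F"
  define H where "H = \<lparr>pverts = W, parcs = {(a, b) \<in> parcs G. a \<in> W \<and> b \<in> W}\<rparr>"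
  define i where "i = the_inv_into (pverts F) g"
  have i: "i (g u) = u" if "u \<in> pverts F" for u
    using the_inv_into_f_f[OF inj that] by (simp add: i_def)
  have wf_H: "wf_digraph (with_proj H)"
    by unfold_locales (auto simp: H_def)
  have "induced_subgraph (with_proj H) (with_proj G)"
    using sub wf_H wf_digraph_axioms
    by (auto simp: induced_subgraph_def subgraph_def compatible_def H_def W_def)
  moreover have "digraph_iso (with_proj H) (with_proj F)"
    unfolding digraph_iso_def
  proof (intro exI conjI)
    let ?hom = "\<lparr>iso_verts = i, iso_arcs = \<lambda>(a, b). (i a, i b), iso_head = snd, iso_tail = fst\<rparr>"
    show "pre_digraph.digraph_isomorphism (with_proj H) ?hom"
      using wf_H i by (auto simp: pre_digraph.digraph_isomorphism_def H_def W_def inj_on_def)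
    have "i ` W = pverts F" using i by (force simp: W_def)
    moreover have "(\<lambda>(a, b). (i a, i b)) ` parcs H = parcs F"
    proof (intro equalityI subsetI)
      fix e assume "e \<in> (\<lambda>(a, b). (i a, i b)) ` parcs H"
      then show "e \<in> parcs F" using i adj by (auto simp: H_def W_def)
    next
      fix e assume e: "e \<in> parcs F"
      obtain u v where uv: "e = (u, v)" by (cases e)
      then have "u \<in> pverts F" "v \<in> pverts F" using e F by auto
      then have "(g u, g v) \<in> parcs H" "e = (i (g u), i (g v))"
        using adj e uv i by (auto simp: H_def W_def)
      then show "e \<in> (\<lambda>(a, b). (i a, i b)) ` parcs H" by force
    qed
    ultimately show "with_proj F = app_iso ?hom (with_proj H)"
      by (auto simp: app_iso_def with_proj_def H_def)
  qed
  ultimately show ?thesis by (auto simp: induced_free_def)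
qed

lemma forbidden_freeI:
  fixes G :: "'a pair_pre_digraph"
  assumes "pair_graph G"
    and "induced_free (with_proj G) (with_proj butterfly)"
    and "induced_free (with_proj G) (with_proj hammer)"
    and "induced_free (with_proj G) (with_proj (graph_join four_cycle (complete_graph p)))"
  shows "forbidden_free (\<lambda>u v. (u, v) \<in> parcs G) p"
proof -
  interpret pair_graph G by fact
  have sym: "(y, x) \<in> parcs G" if "(x, y) \<in> parcs G" for x y
    using arcs_symmetric that .
  have irr: "(x, x) \<notin> parcs G" for x using no_loops' by blast
  have wf: "x \<in> pverts G \<and> y \<in> pverts G" if "(x, y) \<in> parcs G" for x y
    using that wellformed' by blast
  show ?thesis
  proof
    fix a b c d e
    assume E: "(a, b) \<in> parcs G" "(a, c) \<in> parcs G" "(b, c) \<in> parcs G" "(c, d) \<in> parcs G"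
      "(c, e) \<in> parcs G" "(d, e) \<in> parcs G"
    show "(a, d) \<in> parcs G \<or> (a, e) \<in> parcs G \<or> (b, d) \<in> parcs G \<or> (b, e) \<in> parcs G"
    proof (rule ccontr)
      assume N: "\<not> ?thesis"
      \<comment> \<open>The order of the list follows the numbering of \<open>butterfly\<close>, in
        which \<open>2\<close> is the common vertex of the triangles.\<close>
      let ?g = "\<lambda>n :: nat. [a, b, c, d, e] ! n"
      have V: "pverts butterfly = {0, 1, 2, 3, 4}" by (simp add: butterfly_def)
      have A: "parcs butterfly = {(0, 1), (1, 2), (0, 2), (2, 3), (3, 4), (2, 4),
          (1, 0), (2, 1), (2, 0), (3, 2), (4, 3), (4, 2)}"
        by (auto simp: butterfly_def parcs_mk_symmetric)
      \<comment> \<open>Identifying two vertices would turn an edge into a loop or into one of the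
        non-edges.\<close>
      have ne: "a \<noteq> b" "a \<noteq> c" "a \<noteq> d" "a \<noteq> e" "b \<noteq> c" "b \<noteq> d" "b \<noteq> e" "c \<noteq> d" "c \<noteq> e" "d \<noteq> e"
        using E N sym irr by blast+
      have S: "(b, a) \<in> parcs G" "(c, a) \<in> parcs G" "(c, b) \<in> parcs G" "(d, c) \<in> parcs G"
        "(e, c) \<in> parcs G" "(e, d) \<in> parcs G" "(d, a) \<notin> parcs G" "(e, a) \<notin> parcs G"
        "(d, b) \<notin> parcs G" "(e, b) \<notin> parcs G"
        using E N sym by blast+
      have "\<not> induced_free (with_proj G) (with_proj butterfly)"
      proof (rule induced_copy_not_free[where g = ?g])
        show "inj_on ?g (pverts butterfly)" using ne by (simp add: V)
        have "\<forall>u\<in>pverts butterfly. \<forall>v\<in>pverts butterfly. (?g u, ?g v) \<in> parcs G \<longleftrightarrow> (u, v) \<in> parcs butterfly"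
          unfolding V A using E N S irr by simp
        then show "(?g u, ?g v) \<in> parcs G \<longleftrightarrow> (u, v) \<in> parcs butterfly"
          if "u \<in> pverts butterfly" "v \<in> pverts butterfly" for u v
          using that by blast
        show "?g ` pverts butterfly \<subseteq> pverts G" using E wf by (auto simp: V)
      qed (auto simp: A V pair_wf_digraph_axioms)
      then show False using assms by simp
    qed
  next
    fix a b c d e
    assume E: "(a, b) \<in> parcs G" "(a, c) \<in> parcs G" "(b, c) \<in> parcs G" "(c, d) \<in> parcs G"
      "(d, e) \<in> parcs G"
    show "(a, d) \<in> parcs G \<or> (a, e) \<in> parcs G \<or> (b, d) \<in> parcs G \<or> (b, e) \<in> parcs G \<or>
      (c, e) \<in> parcs G"
    proof (rule ccontr)
      assume N: "\<not> ?thesis"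
      let ?g = "\<lambda>n :: nat. [a, b, c, d, e] ! n"
      have V: "pverts hammer = {0, 1, 2, 3, 4}" by (simp add: hammer_def)
      have A: "parcs hammer = {(0, 1), (1, 2), (0, 2), (2, 3), (3, 4),
          (1, 0), (2, 1), (2, 0), (3, 2), (4, 3)}"
        by (auto simp: hammer_def parcs_mk_symmetric)
      have ne: "a \<noteq> b" "a \<noteq> c" "a \<noteq> d" "a \<noteq> e" "b \<noteq> c" "b \<noteq> d" "b \<noteq> e" "c \<noteq> d" "c \<noteq> e" "d \<noteq> e"
        using E N sym irr by blast+
      have S: "(b, a) \<in> parcs G" "(c, a) \<in> parcs G" "(c, b) \<in> parcs G" "(d, c) \<in> parcs G"
        "(e, c) \<notin> parcs G" "(e, d) \<in> parcs G" "(d, a) \<notin> parcs G" "(e, a) \<notin> parcs G"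
        "(d, b) \<notin> parcs G" "(e, b) \<notin> parcs G"
        using E N sym by blast+
      have "\<not> induced_free (with_proj G) (with_proj hammer)"
      proof (rule induced_copy_not_free[where g = ?g])
        show "inj_on ?g (pverts hammer)" using ne by (simp add: V)
        have "\<forall>u\<in>pverts hammer. \<forall>v\<in>pverts hammer. (?g u, ?g v) \<in> parcs G \<longleftrightarrow> (u, v) \<in> parcs hammer"
          unfolding V A using E N S irr by simp
        then show "(?g u, ?g v) \<in> parcs G \<longleftrightarrow> (u, v) \<in> parcs hammer"
          if "u \<in> pverts hammer" "v \<in> pverts hammer" for u v
          using that by blast
        show "?g ` pverts hammer \<subseteq> pverts G" using E wf by (auto simp: V)
      qed (auto simp: A V pair_wf_digraph_axioms)
      then show False using assms by simp
    qed
  next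
    fix w x y z Q
    assume E: "(w, x) \<in> parcs G" "(x, y) \<in> parcs G" "(y, z) \<in> parcs G" "(z, w) \<in> parcs G"
      and N: "w \<noteq> y" "x \<noteq> z" "(w, y) \<notin> parcs G" "(x, z) \<notin> parcs G"
      and "finite Q" and clq: "\<And>u v. u \<in> Q \<Longrightarrow> v \<in> Q \<Longrightarrow> u \<noteq> v \<Longrightarrow> (u, v) \<in> parcs G"
      and join: "\<And>u. u \<in> Q \<Longrightarrow> (w, u) \<in> parcs G \<and> (x, u) \<in> parcs G \<and> (y, u) \<in> parcs G \<and> (z, u) \<in> parcs G"
    show "card Q \<noteq> p"
    proof
      assume "card Q = p"
      then obtain q where "bij_betw q {..<p} Q"
        using ex_bij_betw_nat_finite[OF \<open>finite Q\<close>] by (auto simp: atLeast0LessThan)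
      then have q: "inj_on q {..<p}" "q ` {..<p} = Q" by (auto simp: bij_betw_def)
      then have qQ: "q u \<in> Q" if "u < p" for u using that by blast
      define f where "f n = [w, x, y, z] ! n" for n :: nat
      define X :: "nat set" where "X = {0, 1, 2, 3}"
      let ?g = "case_sum f q"
      let ?F = "graph_join four_cycle (complete_graph p)"
      have V4: "pverts four_cycle = X" by (simp add: four_cycle_def X_def)
      have A4: "parcs four_cycle = {(0, 1), (1, 2), (2, 3), (3, 0), (1, 0), (2, 1), (3, 2), (0, 3)}"
        by (auto simp: four_cycle_def parcs_mk_symmetric)
      have VF: "pverts ?F = Inl ` X \<union> Inr ` {..<p}"
        by (simp add: graph_join_def complete_graph_def V4 Plus_def)
      have ne: "w \<noteq> x" "x \<noteq> y" "y \<noteq> z" "z \<noteq> w" using E irr by blast+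
      have S: "(x, w) \<in> parcs G" "(y, x) \<in> parcs G" "(z, y) \<in> parcs G" "(w, z) \<in> parcs G"
        "(y, w) \<notin> parcs G" "(z, x) \<notin> parcs G"
        using E N sym by blast+
      have inj4: "inj_on f X" using ne N by (simp add: f_def X_def)
      have "\<forall>u\<in>X. \<forall>v\<in>X. (f u, f v) \<in> parcs G \<longleftrightarrow> (u, v) \<in> parcs four_cycle"
        unfolding A4 X_def f_def using E N S irr by simp
      then have adj4: "(f u, f v) \<in> parcs G \<longleftrightarrow> (u, v) \<in> parcs four_cycle"
        if "u \<in> X" "v \<in> X" for u v
        using that by blast
      have cross: "(f u, q v) \<in> parcs G" "(q v, f u) \<in> parcs G" if "u \<in> X" "v < p" for u v
        using that join[OF qQ[OF that(2)]] sym by (auto simp: f_def X_def)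
      \<comment> \<open>The two parts are joined completely, so a common vertex would carry a
        loop.\<close>
      have crossne: "f u \<noteq> q v" "q v \<noteq> f u" if "u \<in> X" "v < p" for u v
        using cross[OF that] irr by metis+
      have qq: "(q u, q v) \<in> parcs G \<longleftrightarrow> u \<noteq> v" if "u < p" "v < p" for u v
        using clq[OF qQ qQ, OF that] irr inj_onD[OF q(1), of u v] that by auto
      have fV: "f u \<in> pverts G" if "u \<in> X" for u
        using that E wf by (auto simp: f_def X_def)
      have qV: "q u \<in> pverts G" if "u < p" for u
        using join[OF qQ[OF that]] wf by blast
      have "\<not> induced_free (with_proj G) (with_proj ?F)"
      proof (rule induced_copy_not_free[where g = ?g])
        show "inj_on ?g (pverts ?F)"
          unfolding VF inj_on_def using crossne by (auto dest: inj_onD[OF inj4] inj_onD[OF q(1)])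
        show "(?g s, ?g t) \<in> parcs G \<longleftrightarrow> (s, t) \<in> parcs ?F"
          if "s \<in> pverts ?F" "t \<in> pverts ?F" for s t
          using that unfolding VF
          by (auto simp: graph_join_def complete_graph_def V4 adj4 cross qq)
        show "?g ` pverts ?F \<subseteq> pverts G"
          unfolding VF using fV qV by auto
        show "parcs ?F \<subseteq> pverts ?F \<times> pverts ?F"
          by (auto simp: graph_join_def complete_graph_def V4 A4 X_def)
      qed (rule pair_wf_digraph_axioms)
      then show False using assms by simp
    qed
  qed (use sym irr in auto)
qed

section \<open>Components as reachability classes\<close>

context pair_graph
begin

text \<open>Paths from \<open>v\<close> stay inside the class, which makes it connected; every
  vertex of a connected supergraph within \<open>G\<close> is reachable from \<open>v\<close>, which
  makes it maximal. This brings the class under the hypothesis on clique numbers.\<close>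

lemma component_in_connected_components:
  assumes "v \<in> pverts G"
  shows "with_proj G \<restriction> {u. v \<rightarrow>\<^sup>*\<^bsub>with_proj G\<^esub> u} \<in> connected_components (with_proj G)"
proof -
  let ?C = "{u. v \<rightarrow>\<^sup>*\<^bsub>with_proj G\<^esub> u}"
  let ?H = "with_proj G \<restriction> ?C"
  have C: "?C \<subseteq> pverts G" using reachable_in_verts(2) by auto
  have sub: "subgraph ?H (with_proj G)"
    using C induced_induce[of ?C] by (auto intro: induced_imp_subgraph)
  have reach: "v \<rightarrow>\<^sup>*\<^bsub>?H\<^esub> u" if "v \<rightarrow>\<^sup>*\<^bsub>with_proj G\<^esub> u" for u
    using that
  proof (induction rule: reachable_induct)
    case base
    then show ?case using assms by (auto simp: reachable_def)
  next
    case (step x y)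
    interpret H: wf_digraph ?H using sub by (auto simp: subgraph_def)
    have "v \<rightarrow>\<^sup>*\<^bsub>with_proj G\<^esub> y" using step by (meson reachable_adj_trans)
    then have "x \<rightarrow>\<^bsub>?H\<^esub> y" using step by (auto simp: arcs_ends_conv)
    then show ?case using step H.reachable_adj_trans by blast
  qed
  interpret H: wf_digraph ?H using sub by (auto simp: subgraph_def)
  have symH: "symmetric ?H"
    using sym_arcs induced_induce[of ?C] C by (auto intro: induced_graph_imp_symmetric)
  have "strongly_connected ?H"
  proof
    show "verts ?H \<noteq> {}" using assms by auto
    fix x y assume "x \<in> verts ?H" "y \<in> verts ?H"
    then have "v \<rightarrow>\<^sup>*\<^bsub>?H\<^esub> x" "v \<rightarrow>\<^sup>*\<^bsub>?H\<^esub> y" using reach by auto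
    then show "x \<rightarrow>\<^sup>*\<^bsub>?H\<^esub> y" using symmetric_reachable[OF symH] H.reachable_trans by blast
  qed
  then have "connected ?H"
    using H.reachable_mk_symmetricI by (auto simp: connected_def strongly_connected_def)
  moreover have "H' = ?H" if H': "subgraph ?H H'" "subgraph H' (with_proj G)" "connected H'" for H'
  proof -
    interpret H': wf_digraph H' using H' by (auto simp: subgraph_def)
    have "u \<in> ?C" if "u \<in> verts H'" for u
    proof -
      have "v \<in> verts H'" using H'(1) assms by (auto simp: subgraph_def)
      \<comment> \<open>\<open>connected\<close> refers to the symmetric closure, which has the same
        reachability as the symmetric graph \<open>G\<close>.\<close>
      then have "v \<rightarrow>\<^sup>*\<^bsub>mk_symmetric H'\<^esub> u"
        using H'(3) that by (auto simp: connected_def strongly_connected_def)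
      moreover have "subgraph (mk_symmetric H') (mk_symmetric (with_proj G))"
        using H'(2) by (rule subgraph_mk_symmetric)
      ultimately have "v \<rightarrow>\<^sup>*\<^bsub>mk_symmetric (with_proj G)\<^esub> u"
        by (rule pre_digraph.reachable_mono)
      then show ?thesis using reachable_mk_symmetric_eq[OF sym_arcs] by simp
    qed
    then have V: "verts H' = ?C" using H'(1) by (auto simp: subgraph_def)
    have th: "tail H' = fst" "head H' = snd" using H'(2) by (auto simp: subgraph_def compatible_def)
    have "arcs H' \<subseteq> arcs ?H"
    proof
      fix e assume e: "e \<in> arcs H'"
      then have "fst e \<in> ?C" "snd e \<in> ?C" using H'.wellformed[OF e] V th by auto
      then show "e \<in> arcs ?H" using e H'(2) by (auto simp: subgraph_def)
    qed
    moreover have "arcs ?H \<subseteq> arcs H'" using H'(1) by (auto simp: subgraph_def)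
    ultimately show ?thesis using V th by (intro pre_digraph.equality) auto
  qed
  ultimately show ?thesis
    using sub by (auto simp: connected_components_def max_subgraph_def)
qed

end

section \<open>Cliques of maximum size\<close>

lemma finite_cliques:
  assumes "finite (verts G)"
  shows "finite {S. clique G S}"
  using assms by (rule finite_subset[rotated, OF finite_Pow_iff[THEN iffD2]]) (auto simp: clique_def)

lemma clique_empty: "clique G {}"
  by (simp add: clique_def)

lemma clique_number_ge:
  assumes "finite (verts G)" "clique G S"
  shows "card S \<le> clique_number G"
  using assms finite_cliques[OF assms(1)] by (auto simp: clique_number_def)

lemma obtain_max_clique:
  assumes "finite (verts G)"
  obtains S where "clique G S" "card S = clique_number G"
proof -
  have "clique_number G \<in> card ` {S. clique G S}"
    unfolding clique_number_def using finite_cliques[OF assms] clique_empty by (intro Max_in) auto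
  then show ?thesis using that by auto
qed

section \<open>Combining the colourings of the components\<close>

theorem theorem3p5:
  fixes p :: nat and G :: "'a pair_pre_digraph"
  assumes "p \<ge> 1"
    and "pair_graph G"
    and "induced_free (with_proj G) (with_proj butterfly)"
    and "induced_free (with_proj G) (with_proj hammer)"
    and "induced_free (with_proj G) (with_proj (graph_join four_cycle (complete_graph p)))"
    and "\<forall>H \<in> connected_components (with_proj G). clique_number H \<noteq> 2"
  shows "chromatic_number (with_proj G) \<le> clique_number (with_proj G) + p * (p + 1) div 2"
proof -
  interpret pair_graph G by fact
  let ?E = "\<lambda>u v. (u, v) \<in> parcs G"
  let ?P = "palette p (clique_number (with_proj G))"
  interpret forbidden_free ?E p using assms(2-5) by (rule forbidden_freeI)
  define C where "C v = {u. v \<rightarrow>\<^sup>*\<^bsub>with_proj G\<^esub> u}" for v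
  have C_sub: "C v \<subseteq> pverts G" for v using reachable_in_verts(2) by (auto simp: C_def)
  have C_self: "v \<in> C v" if "v \<in> pverts G" for v using that by (simp add: C_def)
  have C_adj: "y \<in> C v" if "x \<in> C v" "?E x y" for v x y
    using that reachable_adj_trans[of v x y] by (auto simp: C_def)
  have C_eq: "C u = C w" if "?E u w" for u w
    using that sym reachable_trans[of u w] reachable_trans[of w u] reachable_adjI[of u w] reachable_adjI[of w u]
    by (auto simp: C_def)
  have colour_component: "\<exists>c. (\<forall>u\<in>C v. c u \<in> ?P) \<and> (\<forall>u\<in>C v. \<forall>w\<in>C v. ?E u w \<longrightarrow> c u \<noteq> c w)"
    if v: "v \<in> pverts G" for v
  proof -
    let ?H = "with_proj G \<restriction> C v"
    have fin: "finite (C v)" using C_sub pair_finite_verts finite_subset by blast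
    have clique_H: "clique ?H S \<longleftrightarrow> S \<subseteq> C v \<and> (\<forall>u\<in>S. \<forall>w\<in>S. u \<noteq> w \<longrightarrow> ?E u w)" for S
      by (auto simp: clique_def arcs_ends_conv subset_iff)
    have clique_G: "clique (with_proj G) S" if "clique ?H S" for S
      using that[unfolded clique_H] C_sub[of v] by (auto simp: clique_def)
    have ne2: "clique_number ?H \<noteq> 2"
      using assms(6) component_in_connected_components[OF v] by (auto simp: C_def)
    have finH: "finite (verts ?H)" using fin by simp
    obtain K where K: "clique ?H K" "card K = clique_number ?H"
      using obtain_max_clique[OF finH] by blast
    have K_max: "card S \<le> card K" if "clique ?H S" for S
      using clique_number_ge[OF finH that] K by simp
    have K_le: "card K \<le> clique_number (with_proj G)"
      using clique_number_ge[of "with_proj G" K] clique_G[OF K(1)] pair_finite_verts by simp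
    show ?thesis
    proof (cases "card K \<ge> 3")
      case True
      interpret component_max_clique ?E p "C v" K
      proof
        show "S = C v" if S: "S \<subseteq> C v" "S \<noteq> {}" "\<And>x y. x \<in> S \<Longrightarrow> ?E x y \<Longrightarrow> y \<in> S" for S
        proof -
          obtain x where "x \<in> S" using S by blast
          have "y \<in> S" if "x \<rightarrow>\<^sup>*\<^bsub>with_proj G\<^esub> y" for y
            using that by (induction rule: reachable_induct) (use \<open>x \<in> S\<close> S(3) in auto)
          moreover have "x \<rightarrow>\<^sup>*\<^bsub>with_proj G\<^esub> y" if "y \<in> C v" for y
            using that \<open>x \<in> S\<close> S(1) symmetric_reachable'[of v x] reachable_trans[of x v y]
            by (auto simp: C_def)
          ultimately show ?thesis using S(1) by blast
        qed
        show "card S \<le> card K"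
          if "S \<subseteq> C v" "\<And>u w. u \<in> S \<Longrightarrow> w \<in> S \<Longrightarrow> u \<noteq> w \<Longrightarrow> ?E u w" for S
          using that by (intro K_max) (auto simp: clique_H)
      qed (use fin C_adj K True assms(1) in \<open>auto simp: clique_H\<close>)
      show ?thesis using colouring_exists palette_mono[OF K_le] by blast
    next
      case False
      \<comment> \<open>Clique number two is excluded, so the component has no edge and one colour
        suffices.\<close>
      then have "card K < 2" using ne2 K by simp
      have no_edge: "\<not> ?E u w" if "u \<in> C v" "w \<in> C v" for u w
      proof
        assume "?E u w"
        then have "card {u, w} \<le> card K" using that sym by (intro K_max) (auto simp: clique_H)
        moreover have "u \<noteq> w" using \<open>?E u w\<close> irrefl by blast
        ultimately show False using \<open>card K < 2\<close> by simp
      qed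
      have "card {v} \<le> clique_number (with_proj G)"
        using v pair_finite_verts by (intro clique_number_ge) (auto simp: clique_def)
      then have "{0} \<in> ?P" by (auto simp: palette_def)
      then show ?thesis using no_edge by (intro exI[of _ "\<lambda>_. {0}"]) auto
    qed
  qed
  define good where "good S c \<longleftrightarrow> (\<forall>u\<in>S. c u \<in> ?P) \<and> (\<forall>u\<in>S. \<forall>w\<in>S. ?E u w \<longrightarrow> c u \<noteq> c w)"
    for S and c :: "'a \<Rightarrow> nat set"
  \<comment> \<open>The choice depends only on the set \<open>C v\<close>, which adjacent vertices
    share, so both ends of an edge are coloured by the same colouring.\<close>
  define c where "c v = (SOME c. good (C v) c) v" for v
  have good: "good (C v) (SOME c. good (C v) c)" if "v \<in> pverts G" for v
    using colour_component[OF that] unfolding good_def[symmetric] by (rule someI_ex)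
  have cP: "c v \<in> ?P" if "v \<in> pverts G" for v
    using good[OF that] C_self[OF that] by (auto simp: good_def c_def)
  have proper: "c u \<noteq> c w" if "?E u w" for u w
    using good[of u] C_self[of u] C_self[of w] C_eq[OF that] that wellformed'[OF that]
    by (auto simp: good_def c_def)
  \<comment> \<open>Numbering the palette turns sets into the natural numbers that
    \<open>colourable\<close> asks for.\<close>
  obtain h where h: "bij_betw h ?P {..<card ?P}"
    using ex_bij_betw_finite_nat[OF finite_palette] by (auto simp: atLeast0LessThan)
  have "colourable (with_proj G) (card ?P)"
    unfolding colourable_def
  proof (intro exI[of _ "h \<circ> c"] conjI ballI impI)
    show "(h \<circ> c) v < card ?P" if "v \<in> verts (with_proj G)" for v
      using that cP h by (auto simp: bij_betw_def)
    show "(h \<circ> c) u \<noteq> (h \<circ> c) w"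
      if "u \<in> verts (with_proj G)" "w \<in> verts (with_proj G)" "u \<rightarrow>\<^bsub>with_proj G\<^esub> w" for u w
      using that cP proper[of u w] bij_betw_imp_inj_on[OF h] by (auto dest: inj_onD)
  qed
  then show ?thesis
    unfolding chromatic_number_def card_palette by (rule Least_le)
qed

end
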